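(* Let $J$ be an $n\times n$ information matrix (a real symmetric positive definite matrix) and let $I_1,\dots,I_B$, $1\le B\le n$, be a partition of $\{1,\dots,n\}$ into $B$ disjoint non-empty subsets. For $i,j\in\{1,\dots,B\}$ let $J_{ij}:=J_{I_iI_j}$ be the block of $J$ with rows indexed by $I_i$ and columns indexed by $I_j$, and let $(J^{-1})_{ij}$ denote the block of $J^{-1}$ with rows $I_i$ and columns $I_j$. Let $\mathcal{G}'=(\mathcal{V}',\mathcal{E}')$ be the graph with $\mathcal{V}'=\{1,\dots,B\}$ and $(j,i)\in\mathcal{E}'$ if and only if $J_{I_iI_j}\neq\mathbf{0}$. Then for all $\alpha,\omega\in\mathcal{V}'$, $$(J^{-1})_{\omega\alpha}=\sum_{p\in\Pi_{\mathcal{G}';\alpha\omega}}(-1)^{\ell(p)}\left[\prod_{j=2}^{\ell(p)+1}\Big\{\big((J_{\mathcal{G}'\setminus\{\alpha,\nu_2,\dots,\nu_{j-1}\}})^{-1}\big)_{\nu_j\nu_j}\,J_{\nu_j\nu_{j-1}}\Big\}\right](J^{-1})_{\alpha\alpha},$$ $$(J^{-1})_{\alpha\alpha}=\left(\sum_{\gamma\in\Gamma_{\mathcal{G}';\alpha}}(-1)^{\ell(\gamma)+1}\,J_{\mu_1\mu_{\ell(\gamma)}}\prod_{j=2}^{\ell(\gamma)}\Big\{\big((J_{\mathcal{G}'\setminus\{\alpha,\mu_2,\dots,\mu_{j-1}\}})^{-1}\big)_{\mu_j\mu_j}\,J_{\mu_j\mu_{j-1}}\Big\}\right)^{-1},$$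 where all products are matrix products ordered right-to-left ($\prod_{i=1}^m a_i=a_m\cdots a_1$), the outer inverse is a matrix inverse, $p=(\nu_1,\dots,\nu_{\ell(p)+1})$ is a simple path of length $\ell(p)$ on $\mathcal{G}'$ with $\nu_1=\alpha$, $\nu_{\ell(p)+1}=\omega$, and $\gamma=(\mu_1,\dots,\mu_{\ell(\gamma)},\mu_1)$ is a simple cycle of length $\ell(\gamma)$ on $\mathcal{G}'$ with $\mu_1=\alpha$.
   Context: $\Pi_{\mathcal{G}';\alpha\omega}$ is the (finite) set of simple paths from $\alpha$ to $\omega$ on $\mathcal{G}'$ and $\Gamma_{\mathcal{G}';\alpha}$ the (finite) set of simple cycles from $\alpha$ to itself on $\mathcal{G}'$. A walk of length $\ell$ is a sequence of $\ell+1$ vertices, consecutive ones being joined by an edge. A simple path is a walk whose vertices are all distinct (the trivial walk $(\alpha)$ of length $0$ is the only simple path from $\alpha$ to itself). A simple cycle from $\alpha$ to itself is a walk of length at least $1$ that starts and ends at $\alpha$ and whose intermediate vertices (from the second to the penultimate) are all distinct and different from $\alpha$. In particular the self-loop $(\alpha,\alpha)$ has length 1 and the backtracks $(\alpha,\beta,\alpha)$, $\beta\neq\alpha$, have length 2; a cycle of length at least 3 and its reversal are different simple cycles. Since $J$ is positive definite, each diagonal block is non-zero, so $\mathcal{G}'$ has a self-loop at each vertex. For $S\subset\mathcal{V}'$, $J_{\mathcal{G}'\setminus S}$ is the principal submatrix of $J$ obtained by deleting all rows and columns whose index lies in $\bigcup_{i\in S}I_i$; $\big((J_{\mathcal{G}'\setminus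 S})^{-1}\big)_{\nu\nu}$ is the diagonal block of its inverse with rows and columns $I_\nu$, $\nu\notin S$. For $j=2$ the set $\{\alpha,\nu_2,\dots,\nu_{j-1}\}$ means $\{\alpha\}$ (likewise for the $\mu$'s). Empty products are identity matrices of the appropriate size. *)

theory Defs
  imports
    "Jordan_Normal_Form.DL_Submatrix"
    "Jordan_Normal_Form.Gauss_Jordan_Elimination"
    "Graph_Theory.Pair_Digraph"
    "Graph_Theory.Vertex_Walk"
    "HOL-Library.Disjoint_Sets"
begin

text \<open>Matrix rows and columns are numbered \<open>0, \<dots>, n - 1\<close>, as in \<open>'a mat\<close>; the blocks of the
  partition are numbered \<open>1, \<dots>, B\<close>. A walk \<open>(\<nu>\<^sub>1, \<dots>, \<nu>\<^sub>\<ell>\<^sub>+\<^sub>1)\<close> is the list of its vertices, so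
  \<open>\<nu>\<^sub>j\<close> is \<open>p ! (j - 1)\<close>.\<close>

definition information_matrix :: "nat \<Rightarrow> real mat \<Rightarrow> bool" where
  "information_matrix n J \<longleftrightarrow>
     J \<in> carrier_mat n n \<and> transpose_mat J = J \<and>
     (\<forall>v \<in> carrier_vec n. v \<noteq> 0\<^sub>v n \<longrightarrow> v \<bullet> (J *\<^sub>v v) > 0)"

definition index_partition :: "nat \<Rightarrow> nat \<Rightarrow> (nat \<Rightarrow> nat set) \<Rightarrow> bool" where
  "index_partition n B I \<longleftrightarrow>
     (\<Union>i\<in>{1..B}. I i) = {..<n} \<and> disjoint_family_on I {1..B} \<and> (\<forall>i\<in>{1..B}. I i \<noteq> {})"

text \<open>Unspecified unless the matrix is invertible.\<close>

definition mat_inv :: "'a :: field mat \<Rightarrow> 'a mat" where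
  "mat_inv A = the (mat_inverse A)"

text \<open>\<open>monoid_mat\<close> is the additive monoid of matrices, written multiplicatively; this is the
  matrix analogue of \<open>finsum_vec\<close>.\<close>

definition finsum_mat ::
  "'a :: monoid_add itself \<Rightarrow> nat \<Rightarrow> nat \<Rightarrow> ('c \<Rightarrow> 'a mat) \<Rightarrow> 'c set \<Rightarrow> 'a mat" where
  "finsum_mat ty nr nc = finprod (monoid_mat ty nr nc)"

text \<open>\<open>prod_right_to_left d a m\<close> is \<open>a m * \<dots> * a 1\<close>, where \<open>d\<close> is the number of columns of \<open>a 1\<close>.\<close>

primrec prod_right_to_left ::
  "nat \<Rightarrow> (nat \<Rightarrow> 'a :: semiring_1 mat) \<Rightarrow> nat \<Rightarrow> 'a mat" where
  "prod_right_to_left d a 0 = 1\<^sub>m d"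
| "prod_right_to_left d a (Suc m) = a (Suc m) * prod_right_to_left d a m"

definition block :: "'a mat \<Rightarrow> (nat \<Rightarrow> nat set) \<Rightarrow> nat \<Rightarrow> nat \<Rightarrow> 'a mat" where
  "block A I i j = submatrix A (I i) (I j)"

definition block_graph :: "nat \<Rightarrow> real mat \<Rightarrow> (nat \<Rightarrow> nat set) \<Rightarrow> nat pair_pre_digraph" where
  "block_graph B J I =
     \<lparr> pverts = {1..B},
       parcs = {(j, i). i \<in> {1..B} \<and> j \<in> {1..B} \<and>
                        block J I i j \<noteq> 0\<^sub>m (card (I i)) (card (I j))} \<rparr>"

definition remaining_indices :: "nat \<Rightarrow> (nat \<Rightarrow> nat set) \<Rightarrow> nat set \<Rightarrow> nat set" where
  "remaining_indices n I S = {..<n} - (\<Union>i\<in>S. I i)"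

definition delete_blocks :: "real mat \<Rightarrow> (nat \<Rightarrow> nat set) \<Rightarrow> nat set \<Rightarrow> real mat" where
  "delete_blocks J I S =
     (let R = remaining_indices (dim_row J) I S in submatrix J R R)"

text \<open>In \<open>delete_blocks J I S\<close> the surviving row (or column) \<open>i\<close> of \<open>J\<close> has the number
  \<open>card {a \<in> R. a < i}\<close>, where \<open>R\<close> is the set of surviving indices.\<close>

definition deleted_inv_block :: "real mat \<Rightarrow> (nat \<Rightarrow> nat set) \<Rightarrow> nat set \<Rightarrow> nat \<Rightarrow> real mat" where
  "deleted_inv_block J I S \<nu> =
     (let R = remaining_indices (dim_row J) I S;
          K = (\<lambda>i. card {a \<in> R. a < i}) ` I \<nu>
      in submatrix (mat_inv (delete_blocks J I S)) K K)"

definition simple_paths :: "'a pair_pre_digraph \<Rightarrow> 'a \<Rightarrow> 'a \<Rightarrow> 'a vwalk set" where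
  "simple_paths G \<alpha> \<omega> = {p. vpath p (with_proj G) \<and> hd p = \<alpha> \<and> last p = \<omega>}"

definition simple_cycles :: "'a pair_pre_digraph \<Rightarrow> 'a \<Rightarrow> 'a vwalk set" where
  "simple_cycles G \<alpha> =
     {c. vwalk c (with_proj G) \<and> vwalk_length c \<ge> 1 \<and> hd c = \<alpha> \<and> last c = \<alpha> \<and>
         distinct (tl (butlast c)) \<and> \<alpha> \<notin> set (tl (butlast c))}"

text \<open>For a walk \<open>p\<close> starting at \<open>\<alpha>\<close>, the factor with (1-based) index \<open>j + 1\<close>: the deleted
  vertices \<open>\<alpha>, \<nu>\<^sub>2, \<dots>, \<nu>\<^sub>j\<close> are the first \<open>j\<close> entries of \<open>p\<close>.\<close>

definition walk_factor :: "real mat \<Rightarrow> (nat \<Rightarrow> nat set) \<Rightarrow> nat vwalk \<Rightarrow> nat \<Rightarrow> real mat" where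
  "walk_factor J I p j =
     deleted_inv_block J I (set (take j p)) (p ! j) * block J I (p ! j) (p ! (j - 1))"

definition path_term :: "real mat \<Rightarrow> (nat \<Rightarrow> nat set) \<Rightarrow> nat vwalk \<Rightarrow> real mat" where
  "path_term J I p =
     (-1) ^ vwalk_length p \<cdot>\<^sub>m
       (prod_right_to_left (card (I (hd p))) (walk_factor J I p) (vwalk_length p)
         * block (mat_inv J) I (hd p) (hd p))"

definition cycle_term :: "real mat \<Rightarrow> (nat \<Rightarrow> nat set) \<Rightarrow> nat vwalk \<Rightarrow> real mat" where
  "cycle_term J I c =
     (-1) ^ (vwalk_length c + 1) \<cdot>\<^sub>m
       (block J I (hd c) (c ! (vwalk_length c - 1))
         * prod_right_to_left (card (I (hd c))) (walk_factor J I c) (vwalk_length c - 1))"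

end

theory Submission
  imports Defs "HOL-Library.Function_Algebras" "Jordan_Normal_Form.Determinant"
begin

text \<open>Blocks of a matrix are read as \<open>e \<beta> * J * e \<alpha>\<close>, where the diagonal block projections \<open>e \<beta>\<close>
  are orthogonal idempotents of a ring, and \<open>N S\<close> is the inverse of \<open>J\<close> in the corner spanned by
  the blocks outside \<open>S\<close>. Block elimination of \<open>\<alpha>\<close> says
  \<open>N S * e \<alpha> = (e \<alpha> - N (S \<union> {\<alpha>}) * J * e \<alpha>) * N S * e \<alpha>\<close>. Applied again and again, to the
  columns of \<open>N (S \<union> {\<alpha>})\<close> next, it unfolds \<open>e \<alpha> - N (S \<union> {\<alpha>}) * J * e \<alpha>\<close> into the sum of the
  signed products along all simple paths that start at \<open>\<alpha>\<close> and avoid \<open>S\<close>. For \<open>S = {}\<close>, multiplying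
  by \<open>e \<omega>\<close> from the left selects the paths to \<open>\<omega>\<close>, while multiplying by \<open>e \<alpha> * J\<close> closes the paths
  to cycles and turns the sum into a Schur complement, the inverse of \<open>e \<alpha> * N {} * e \<alpha>\<close>.\<close>

section \<open>Matrices indexed by finite sets of natural numbers\<close>

definition rank_in :: "nat set \<Rightarrow> nat \<Rightarrow> nat" where
  "rank_in X i = card {a \<in> X. a < i}"

lemma pick_rank_in: "i \<in> X \<Longrightarrow> pick X (rank_in X i) = i"
  unfolding rank_in_def by (rule pick_card_in_set)

lemma rank_in_pick: "k < card X \<Longrightarrow> rank_in X (pick X k) = k"
  unfolding rank_in_def by (simp add: card_pick)

lemma rank_in_less_card: "finite X \<Longrightarrow> i \<in> X \<Longrightarrow> rank_in X i < card X"
  unfolding rank_in_def by (rule psubset_card_mono) auto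

lemma rank_in_less_iff:
  assumes "finite X" "i \<in> X" "j \<in> X"
  shows "rank_in X i < rank_in X j \<longleftrightarrow> i < j"
proof -
  have "rank_in X a < rank_in X b" if "a \<in> X" "a < b" for a b
    unfolding rank_in_def using assms(1) that by (intro psubset_card_mono) auto
  then show ?thesis using assms by (metis linorder_neqE_nat less_asym)
qed

lemma inj_on_rank_in: "inj_on (rank_in X) X"
  by (rule inj_on_inverseI[of _ "pick X"]) (rule pick_rank_in)

lemma bij_betw_pick: "finite X \<Longrightarrow> bij_betw (pick X) {..<card X} X"
  by (rule bij_betw_byWitness[where f' = "rank_in X"])
    (auto simp: rank_in_pick pick_rank_in rank_in_less_card pick_in_set)

lemma rank_in_image_rank_in:
  assumes "finite R" "X \<subseteq> R" "x \<in> X"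
  shows "rank_in (rank_in R ` X) (rank_in R x) = rank_in X x"
proof -
  have "{a \<in> rank_in R ` X. a < rank_in R x} = rank_in R ` {a \<in> X. a < x}"
    using rank_in_less_iff[OF assms(1)] assms(2,3) by blast
  moreover have "inj_on (rank_in R) {a \<in> X. a < x}"
    by (rule inj_on_subset[OF inj_on_rank_in]) (use assms in auto)
  ultimately show ?thesis
    unfolding rank_in_def[of "rank_in R ` X"] rank_in_def[of X] by (simp add: card_image)
qed

lemma rank_in_lessThan:
  assumes "i < n"
  shows "rank_in {..<n} i = i"
proof -
  have "{a \<in> {..<n}. a < i} = {..<i}" using assms by auto
  then show ?thesis by (simp add: rank_in_def)
qed

definition mat_on :: "nat set \<Rightarrow> nat set \<Rightarrow> (nat \<Rightarrow> nat \<Rightarrow> 'a) \<Rightarrow> 'a mat" where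
  "mat_on X Y f = mat (card X) (card Y) (\<lambda>(i, j). f (pick X i) (pick Y j))"

lemma mat_on_carrier [simp]: "mat_on X Y f \<in> carrier_mat (card X) (card Y)"
  and dim_row_mat_on [simp]: "dim_row (mat_on X Y f) = card X"
  and dim_col_mat_on [simp]: "dim_col (mat_on X Y f) = card Y"
  by (simp_all add: mat_on_def)

lemma mat_on_cong:
  "(\<And>i j. i \<in> X \<Longrightarrow> j \<in> Y \<Longrightarrow> f i j = g i j) \<Longrightarrow> mat_on X Y f = mat_on X Y g"
  by (intro eq_matI) (auto simp: mat_on_def pick_in_set)

lemma mat_on_index:
  "finite X \<Longrightarrow> finite Y \<Longrightarrow> i \<in> X \<Longrightarrow> j \<in> Y \<Longrightarrow>
    mat_on X Y f $$ (rank_in X i, rank_in Y j) = f i j"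
  by (simp add: mat_on_def rank_in_less_card pick_rank_in)

lemma mat_on_rank_in:
  assumes "A \<in> carrier_mat (card X) (card Y)"
  shows "mat_on X Y (\<lambda>i j. A $$ (rank_in X i, rank_in Y j)) = A"
  by (rule eq_matI) (use assms in \<open>auto simp: mat_on_def rank_in_pick\<close>)

lemma mat_on_lessThan:
  assumes "A \<in> carrier_mat m n"
  shows "mat_on {..<m} {..<n} (\<lambda>i j. A $$ (i, j)) = A"
proof -
  have "mat_on {..<m} {..<n} (\<lambda>i j. A $$ (i, j)) =
      mat_on {..<m} {..<n} (\<lambda>i j. A $$ (rank_in {..<m} i, rank_in {..<n} j))"
    by (rule mat_on_cong) (simp add: rank_in_lessThan)
  then show ?thesis using mat_on_rank_in[of A "{..<m}" "{..<n}"] assms by simp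
qed

lemma submatrix_eq_mat_on:
  assumes "A \<in> carrier_mat m n" "X \<subseteq> {..<m}" "Y \<subseteq> {..<n}"
  shows "submatrix A X Y = mat_on X Y (\<lambda>i j. A $$ (i, j))"
proof -
  have "{i. i < m \<and> i \<in> X} = X" "{j. j < n \<and> j \<in> Y} = Y" using assms by auto
  then show ?thesis using assms(1) by (simp add: submatrix_def mat_on_def)
qed

lemma submatrix_image_rank_in:
  assumes A: "A \<in> carrier_mat (card R) (card S)"
    and fin: "finite R" "finite S" and sub: "X \<subseteq> R" "Y \<subseteq> S"
  shows "submatrix A (rank_in R ` X) (rank_in S ` Y) =
    mat_on X Y (\<lambda>i j. A $$ (rank_in R i, rank_in S j))"
proof -
  let ?X = "rank_in R ` X" and ?Y = "rank_in S ` Y"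
  have card: "card ?X = card X" "card ?Y = card Y"
    by (auto intro!: card_image inj_on_subset[OF inj_on_rank_in] sub)
  have "?X \<subseteq> {..<card R}" "?Y \<subseteq> {..<card S}"
    using fin sub rank_in_less_card by auto
  then have M: "submatrix A ?X ?Y = mat_on ?X ?Y (\<lambda>i j. A $$ (i, j))"
    by (rule submatrix_eq_mat_on[OF A])
  then have "submatrix A ?X ?Y \<in> carrier_mat (card X) (card Y)"
    using mat_on_carrier[of ?X ?Y] card by metis
  then have "submatrix A ?X ?Y =
      mat_on X Y (\<lambda>i j. submatrix A ?X ?Y $$ (rank_in X i, rank_in Y j))"
    by (rule mat_on_rank_in[symmetric])
  also have "\<dots> = mat_on X Y (\<lambda>i j. A $$ (rank_in R i, rank_in S j))"
  proof (rule mat_on_cong)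
    fix i j assume ij: "i \<in> X" "j \<in> Y"
    have "finite ?X" "finite ?Y" using fin sub by (auto intro: finite_subset)
    then have "submatrix A ?X ?Y $$ (rank_in ?X (rank_in R i), rank_in ?Y (rank_in S j)) =
        A $$ (rank_in R i, rank_in S j)"
      unfolding M using ij by (intro mat_on_index) auto
    then show "submatrix A ?X ?Y $$ (rank_in X i, rank_in Y j) = A $$ (rank_in R i, rank_in S j)"
      using ij fin sub by (simp add: rank_in_image_rank_in)
  qed
  finally show ?thesis .
qed

lemma mat_on_mult:
  assumes "finite K"
  shows "mat_on X K f * mat_on K Y g = mat_on X Y (\<lambda>i j. \<Sum>k\<in>K. f i k * g k j)"
    (is "?L = ?R")
proof (rule eq_matI)
  fix i j assume "i < dim_row ?R" "j < dim_col ?R"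
  then have ij: "i < card X" "j < card Y" by simp_all
  have "?L $$ (i, j) = (\<Sum>k<card K. f (pick X i) (pick K k) * g (pick K k) (pick Y j))"
    using ij by (simp add: mat_on_def scalar_prod_def atLeast0LessThan)
  also have "\<dots> = (\<Sum>k\<in>K. f (pick X i) k * g k (pick Y j))"
    by (rule sum.reindex_bij_betw[OF bij_betw_pick[OF assms]])
  finally show "?L $$ (i, j) = ?R $$ (i, j)" using ij by (simp add: mat_on_def)
qed simp_all

lemma mat_on_of_bool_eq: "mat_on X X (\<lambda>i j. of_bool (i = j)) = 1\<^sub>m (card X)"
proof (rule eq_matI)
  fix i j assume "i < dim_row (1\<^sub>m (card X) :: 'a mat)" "j < dim_col (1\<^sub>m (card X) :: 'a mat)"
  then have ij: "i < card X" "j < card X" by simp_all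
  then have "pick X i = pick X j \<longleftrightarrow> i = j" by (metis rank_in_pick)
  then show "mat_on X X (\<lambda>i j. of_bool (i = j)) $$ (i, j) = (1\<^sub>m (card X) :: 'a mat) $$ (i, j)"
    using ij by (simp add: mat_on_def)
qed simp_all

lemma mat_on_zero: "mat_on X Y 0 = 0\<^sub>m (card X) (card Y)"
  by (rule eq_matI) (simp_all add: mat_on_def)

lemma mat_on_uminus: "mat_on X Y (- f) = - mat_on X Y f"
  by (rule eq_matI) (simp_all add: mat_on_def)

lemma mat_on_plus: "mat_on X Y (f + g) = mat_on X Y f + mat_on X Y g"
  by (rule eq_matI) (simp_all add: mat_on_def)

lemma finsum_mat_mat_on:
  fixes f :: "'c \<Rightarrow> nat \<Rightarrow> nat \<Rightarrow> 'a :: comm_monoid_add"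
  assumes "finite A" "\<And>x. x \<in> A \<Longrightarrow> F x = mat_on X Y (f x)"
  shows "finsum_mat TYPE('a) (card X) (card Y) F A = mat_on X Y (\<Sum>x\<in>A. f x)"
proof -
  interpret comm_monoid "monoid_mat TYPE('a) (card X) (card Y)" by (rule comm_monoid_mat)
  show ?thesis
    using assms
  proof (induction A rule: finite_induct)
    case empty
    show ?case
      unfolding finsum_mat_def finprod_empty sum.empty mat_on_zero by (simp add: monoid_mat_def)
  next
    case (insert x A)
    then have F: "F \<in> A \<rightarrow> carrier (monoid_mat TYPE('a) (card X) (card Y))"
      "F x \<in> carrier (monoid_mat TYPE('a) (card X) (card Y))"
      by (auto simp: monoid_mat_def)
    have "finsum_mat TYPE('a) (card X) (card Y) F (insert x A) =
        F x + finsum_mat TYPE('a) (card X) (card Y) F A"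
      unfolding finsum_mat_def using finprod_insert[OF insert.hyps F] by (simp add: monoid_mat_def)
    then show ?case
      unfolding sum.insert[OF insert.hyps] mat_on_plus using insert by simp
  qed
qed

lemma one_smult_mat: "(1 :: 'a :: semiring_1) \<cdot>\<^sub>m A = A"
  by (rule eq_matI) simp_all

lemma smult_smult_mat: "(a :: 'a :: semiring_0) \<cdot>\<^sub>m (b \<cdot>\<^sub>m A) = (a * b) \<cdot>\<^sub>m A"
  by (rule eq_matI) (simp_all add: mult.assoc)

section \<open>Inverses of principal submatrices\<close>

lemma
  fixes A :: "'a :: field mat"
  assumes A: "A \<in> carrier_mat m m" and "det A \<noteq> 0"
  shows mat_inv_carrier: "mat_inv A \<in> carrier_mat m m"
    and mult_mat_inv: "A * mat_inv A = 1\<^sub>m m"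
    and mat_inv_mult: "mat_inv A * A = 1\<^sub>m m"
proof -
  obtain X where "mat_inverse A = Some X"
    using mat_inverse(1)[OF A] det_non_zero_imp_unit[OF assms] by fastforce
  then show "mat_inv A \<in> carrier_mat m m" "A * mat_inv A = 1\<^sub>m m" "mat_inv A * A = 1\<^sub>m m"
    using mat_inverse(2)[OF A] by (auto simp: mat_inv_def)
qed

lemma
  fixes A :: "'a :: field mat"
  assumes A: "A \<in> carrier_mat m m" and X: "X \<in> carrier_mat m m" and AX: "A * X = 1\<^sub>m m"
  shows invertible_matI: "invertible_mat A" and mat_inv_eqI: "mat_inv A = X"
proof -
  show "invertible_mat A"
    unfolding invertible_mat_def inverts_mat_def
    using A X AX mat_mult_left_right_inverse[OF A X AX] by auto
  have "det A * det X = 1" using det_mult[OF A X] AX by simp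
  then have "det A \<noteq> 0" by auto
  note inv = mat_inv_carrier[OF A this] mat_inv_mult[OF A this]
  have "mat_inv A = mat_inv A * (A * X)" using inv(1) AX by simp
  also have "\<dots> = mat_inv A * A * X" by (rule assoc_mult_mat[symmetric, OF inv(1) A X])
  also have "\<dots> = X" using inv(2) X by simp
  finally show "mat_inv A = X" .
qed

lemma quadratic_form_eq_sum:
  fixes v :: "'a :: semiring_0 vec"
  assumes "A \<in> carrier_mat n n" "v \<in> carrier_vec n"
  shows "v \<bullet> (A *\<^sub>v v) = (\<Sum>i<n. \<Sum>j<n. v $ i * (A $$ (i, j) * v $ j))"
  using assms by (simp add: scalar_prod_def atLeast0LessThan sum_distrib_left)

definition zero_extension :: "nat \<Rightarrow> nat set \<Rightarrow> 'a :: zero vec \<Rightarrow> 'a vec" where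
  "zero_extension n R v = vec n (\<lambda>i. if i \<in> R then v $ rank_in R i else 0)"

lemma zero_extension_carrier [simp]: "zero_extension n R v \<in> carrier_vec n"
  by (simp add: zero_extension_def)

lemma zero_extension_pick:
  "R \<subseteq> {..<n} \<Longrightarrow> k < card R \<Longrightarrow> zero_extension n R v $ pick R k = v $ k"
  using pick_in_set[of k R] by (auto simp: zero_extension_def rank_in_pick)

lemma zero_extension_eq_zeroD:
  assumes "zero_extension n R v = 0\<^sub>v n" "R \<subseteq> {..<n}" "v \<in> carrier_vec (card R)"
  shows "v = 0\<^sub>v (card R)"
proof (rule eq_vecI)
  fix k assume "k < dim_vec (0\<^sub>v (card R) :: 'a vec)"
  then have k: "k < card R" by simp
  then have "pick R k < n" using assms(2) pick_in_set[of k R] by auto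
  then show "v $ k = 0\<^sub>v (card R) $ k"
    using zero_extension_pick[OF assms(2) k, of v] assms(1) k by simp
qed (use assms(3) in simp)

lemma quadratic_form_submatrix:
  fixes v :: "'a :: semiring_0 vec"
  assumes J: "J \<in> carrier_mat n n" and R: "R \<subseteq> {..<n}" and v: "v \<in> carrier_vec (card R)"
  shows "v \<bullet> (submatrix J R R *\<^sub>v v) = zero_extension n R v \<bullet> (J *\<^sub>v zero_extension n R v)"
proof -
  let ?w = "zero_extension n R v"
  have fin: "finite R" using R finite_subset by blast
  have "v \<bullet> (submatrix J R R *\<^sub>v v) = (\<Sum>k<card R. \<Sum>l<card R.
      ?w $ pick R k * (J $$ (pick R k, pick R l) * ?w $ pick R l))"
    unfolding submatrix_eq_mat_on[OF J R R] quadratic_form_eq_sum[OF mat_on_carrier v]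
    by (simp add: mat_on_def zero_extension_pick[OF R])
  also have "\<dots> = (\<Sum>i\<in>R. \<Sum>j\<in>R. ?w $ i * (J $$ (i, j) * ?w $ j))"
    by (subst (1 2) sum.reindex_bij_betw[OF bij_betw_pick[OF fin], symmetric]) (rule refl)
  also have "\<dots> = (\<Sum>i<n. \<Sum>j<n. ?w $ i * (J $$ (i, j) * ?w $ j))"
    using R by (intro sum.mono_neutral_cong_left) (auto simp: zero_extension_def)
  also have "\<dots> = ?w \<bullet> (J *\<^sub>v ?w)"
    by (rule quadratic_form_eq_sum[OF J zero_extension_carrier, symmetric])
  finally show ?thesis .
qed

lemma information_matrix_submatrix:
  assumes "information_matrix n J" and R: "R \<subseteq> {..<n}"
  shows "information_matrix (card R) (submatrix J R R)"
proof -
  have J: "J \<in> carrier_mat n n" "transpose_mat J = J"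
    and pos: "\<And>v. v \<in> carrier_vec n \<Longrightarrow> v \<noteq> 0\<^sub>v n \<Longrightarrow> v \<bullet> (J *\<^sub>v v) > 0"
    using assms(1) by (auto simp: information_matrix_def)
  have sym: "J $$ (i, j) = J $$ (j, i)" if "i < n" "j < n" for i j
    using that J by (metis carrier_matD index_transpose_mat(1))
  note sub = submatrix_eq_mat_on[OF J(1) R R]
  have "transpose_mat (submatrix J R R) = submatrix J R R"
    unfolding sub by (rule eq_matI)
      (use R pick_in_set[of _ R] in \<open>auto simp: mat_on_def intro!: sym\<close>)
  moreover have "v \<bullet> (submatrix J R R *\<^sub>v v) > 0"
    if "v \<in> carrier_vec (card R)" "v \<noteq> 0\<^sub>v (card R)" for v
    unfolding quadratic_form_submatrix[OF J(1) R that(1)]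
    using zero_extension_eq_zeroD[OF _ R that(1)] that(2) by (intro pos) auto
  ultimately show ?thesis using sub by (simp add: information_matrix_def)
qed

lemma information_matrix_det_nonzero:
  assumes "information_matrix n J"
  shows "det J \<noteq> 0"
proof
  assume "det J = 0"
  then obtain v where v: "v \<in> carrier_vec n" "v \<noteq> 0\<^sub>v n" and Jv: "J *\<^sub>v v = 0\<^sub>v n"
    using assms det_0_iff_vec_prod_zero[of J n] by (auto simp: information_matrix_def)
  have "v \<bullet> (J *\<^sub>v v) > 0" using assms v by (simp add: information_matrix_def)
  then show False using v(1) by (simp add: Jv)
qed

section \<open>Path sums in a ring with orthogonal idempotents\<close>

text \<open>The product is a parameter because kernels are multiplied by summing over a chosen index set,
  which no type class instance can depend on.\<close>

locale rng_product = rng: Rings.ring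
  where plus = "(+)" and zero = 0 and minus = "(-)" and uminus = uminus and times = mult
  for mult :: "'a :: ab_group_add \<Rightarrow> 'a \<Rightarrow> 'a" (infixl "\<star>" 70)
begin

lemma mult_sum_distrib_left: "a \<star> (\<Sum>x\<in>A. f x) = (\<Sum>x\<in>A. a \<star> f x)"
  by (induction A rule: infinite_finite_induct) (simp_all add: algebra_simps)

lemma mult_sum_distrib_right: "(\<Sum>x\<in>A. f x) \<star> a = (\<Sum>x\<in>A. f x \<star> a)"
  by (induction A rule: infinite_finite_induct) (simp_all add: algebra_simps)

end

locale orthogonal_idempotents = rng_product mult
  for mult :: "'a :: ab_group_add \<Rightarrow> 'a \<Rightarrow> 'a" (infixl "\<star>" 70) +
  fixes V :: "'v set" and e :: "'v \<Rightarrow> 'a"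
  assumes finite_V: "finite V"
    and idempotent: "\<beta> \<in> V \<Longrightarrow> e \<beta> \<star> e \<beta> = e \<beta>"
    and orthogonal: "\<beta> \<in> V \<Longrightarrow> \<gamma> \<in> V \<Longrightarrow> \<beta> \<noteq> \<gamma> \<Longrightarrow> e \<beta> \<star> e \<gamma> = 0"
begin

definition unit_outside :: "'v set \<Rightarrow> 'a" where
  "unit_outside S = (\<Sum>\<beta>\<in>V - S. e \<beta>)"

lemma idempotent_mult_unit_outside:
  assumes "\<beta> \<in> V"
  shows "e \<beta> \<star> unit_outside S = (if \<beta> \<in> S then 0 else e \<beta>)"
proof -
  have "e \<beta> \<star> unit_outside S = (\<Sum>\<gamma>\<in>V - S. if \<gamma> = \<beta> then e \<beta> else 0)"
    unfolding unit_outside_def mult_sum_distrib_left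
    using assms idempotent orthogonal by (intro sum.cong) auto
  then show ?thesis using assms finite_V by simp
qed

lemma unit_outside_mult_idempotent:
  assumes "\<beta> \<in> V"
  shows "unit_outside S \<star> e \<beta> = (if \<beta> \<in> S then 0 else e \<beta>)"
proof -
  have "unit_outside S \<star> e \<beta> = (\<Sum>\<gamma>\<in>V - S. if \<gamma> = \<beta> then e \<beta> else 0)"
    unfolding unit_outside_def mult_sum_distrib_right
    using assms idempotent orthogonal by (intro sum.cong) auto
  then show ?thesis using assms finite_V by simp
qed

lemma unit_outside_remove:
  "\<alpha> \<in> V - S \<Longrightarrow> unit_outside S = e \<alpha> + unit_outside (insert \<alpha> S)"
  using finite_V by (simp add: unit_outside_def sum.remove[of "V - S" \<alpha>] Diff_insert[of V \<alpha> S])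

lemma unit_outside_insert_mult:
  "unit_outside (insert \<alpha> S) \<star> unit_outside S = unit_outside (insert \<alpha> S)"
  by (simp add: unit_outside_def[of "insert \<alpha> S"] mult_sum_distrib_right
      idempotent_mult_unit_outside)

end

text \<open>\<open>N S\<close> stands for the inverse of \<open>J\<close> with the blocks in \<open>S\<close> deleted, padded by zero blocks.\<close>

locale deleted_inverses = orthogonal_idempotents mult "pverts G" e
  for mult :: "'a :: ab_group_add \<Rightarrow> 'a \<Rightarrow> 'a" (infixl "\<star>" 70)
    and G :: "'v pair_pre_digraph" and e :: "'v \<Rightarrow> 'a" +
  fixes J :: 'a and N :: "'v set \<Rightarrow> 'a"
  assumes unit_mult_N: "S \<subseteq> pverts G \<Longrightarrow> unit_outside S \<star> N S = N S"
    and N_mult_unit: "S \<subseteq> pverts G \<Longrightarrow> N S \<star> unit_outside S = N S"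
    and J_mult_N: "S \<subseteq> pverts G \<Longrightarrow> unit_outside S \<star> J \<star> N S = unit_outside S"
    and N_mult_J: "S \<subseteq> pverts G \<Longrightarrow> N S \<star> J \<star> unit_outside S = unit_outside S"
    and no_arc: "\<beta> \<in> pverts G \<Longrightarrow> \<gamma> \<in> pverts G \<Longrightarrow> (\<beta>, \<gamma>) \<notin> parcs G \<Longrightarrow> e \<gamma> \<star> J \<star> e \<beta> = 0"
begin

abbreviation V :: "'v set" where "V \<equiv> pverts G"

theorem N_column_elimination:
  assumes "S \<subseteq> V" "\<alpha> \<in> V - S"
  shows "(e \<alpha> - N (insert \<alpha> S) \<star> J \<star> e \<alpha>) \<star> N S \<star> e \<alpha> = N S \<star> e \<alpha>"
proof -
  let ?S = "insert \<alpha> S"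
  have S: "?S \<subseteq> V" using assms by simp
  have split: "N S = e \<alpha> \<star> N S + unit_outside ?S \<star> N S"
    using unit_mult_N[OF assms(1)] by (simp add: unit_outside_remove[OF assms(2)] rng.distrib_right)
  have "N ?S \<star> J \<star> N S = N ?S \<star> J \<star> e \<alpha> \<star> N S + N ?S \<star> J \<star> unit_outside ?S \<star> N S"
    using arg_cong[OF split, of "\<lambda>x. N ?S \<star> J \<star> x"]
    by (simp add: rng.distrib_left flip: rng.mult.assoc)
  then have rows: "unit_outside ?S \<star> N S = N ?S \<star> J \<star> N S - N ?S \<star> J \<star> e \<alpha> \<star> N S"
    using N_mult_J[OF S] by simp
  have "N ?S \<star> J \<star> N S \<star> e \<alpha> = N ?S \<star> unit_outside ?S \<star> (unit_outside S \<star> J \<star> N S) \<star> e \<alpha>"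
    using N_mult_unit[OF S] unit_outside_insert_mult[of \<alpha> S] by (metis rng.mult.assoc)
  also have "\<dots> = N ?S \<star> (unit_outside ?S \<star> e \<alpha>)"
    using J_mult_N[OF assms(1)] unit_outside_insert_mult[of \<alpha> S] by (metis rng.mult.assoc)
  also have "\<dots> = 0" using assms by (simp add: unit_outside_mult_idempotent)
  finally have "unit_outside ?S \<star> N S \<star> e \<alpha> = - (N ?S \<star> J \<star> e \<alpha> \<star> N S \<star> e \<alpha>)"
    unfolding rows by (simp add: rng.left_diff_distrib)
  then have "N S \<star> e \<alpha> = e \<alpha> \<star> N S \<star> e \<alpha> - N ?S \<star> J \<star> e \<alpha> \<star> N S \<star> e \<alpha>"
    using arg_cong[OF split, of "\<lambda>x. x \<star> e \<alpha>"] by (simp add: rng.distrib_right)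
  then show ?thesis by (simp add: rng.left_diff_distrib)
qed

theorem schur_complement_mult_N:
  assumes "S \<subseteq> V" "\<alpha> \<in> V - S"
  shows "e \<alpha> \<star> J \<star> (e \<alpha> - N (insert \<alpha> S) \<star> J \<star> e \<alpha>) \<star> N S \<star> e \<alpha> = e \<alpha>"
proof -
  have "e \<alpha> \<star> J \<star> (e \<alpha> - N (insert \<alpha> S) \<star> J \<star> e \<alpha>) \<star> N S \<star> e \<alpha> = e \<alpha> \<star> J \<star> (N S \<star> e \<alpha>)"
    using N_column_elimination[OF assms] by (simp add: rng.mult.assoc)
  also have "\<dots> = e \<alpha> \<star> (unit_outside S \<star> J \<star> N S) \<star> e \<alpha>"
    using idempotent_mult_unit_outside[of \<alpha> S] assms by (simp flip: rng.mult.assoc)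
  also have "\<dots> = e \<alpha>"
    using assms by (simp add: J_mult_N idempotent_mult_unit_outside idempotent)
  finally show ?thesis .
qed

fun path_prod :: "'v set \<Rightarrow> 'v list \<Rightarrow> 'a" where
  "path_prod S [] = 0"
| "path_prod S [\<alpha>] = e \<alpha>"
| "path_prod S (\<alpha> # \<beta> # p) =
    - (path_prod (insert \<alpha> S) (\<beta> # p) \<star> N (insert \<alpha> S) \<star> e \<beta> \<star> J \<star> e \<alpha>)"

definition paths_avoiding :: "'v set \<Rightarrow> 'v \<Rightarrow> 'v list set" where
  "paths_avoiding S \<alpha> = {p. p \<noteq> [] \<and> distinct p \<and> set p \<subseteq> V - S \<and> hd p = \<alpha>}"

lemma finite_paths_avoiding: "finite (paths_avoiding S \<alpha>)"
  by (rule finite_subset[OF _ finite_subset_distinct[OF finite_V]])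
    (auto simp: paths_avoiding_def)

lemma paths_avoiding_rec:
  assumes "\<alpha> \<in> V - S"
  shows "paths_avoiding S \<alpha> =
    insert [\<alpha>] ((#) \<alpha> ` (\<Union>\<beta>\<in>V - insert \<alpha> S. paths_avoiding (insert \<alpha> S) \<beta>))"
proof (intro equalityI subsetI)
  fix p assume p: "p \<in> paths_avoiding S \<alpha>"
  then obtain q where q: "p = \<alpha> # q" by (cases p) (auto simp: paths_avoiding_def)
  show "p \<in> insert [\<alpha>] ((#) \<alpha> ` (\<Union>\<beta>\<in>V - insert \<alpha> S. paths_avoiding (insert \<alpha> S) \<beta>))"
  proof (cases "q = []")
    case False
    then have "hd q \<in> V - insert \<alpha> S" "q \<in> paths_avoiding (insert \<alpha> S) (hd q)"
      using p q by (auto simp: paths_avoiding_def dest: hd_in_set)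
    then show ?thesis using q by blast
  qed (use q in simp)
qed (use assms in \<open>auto simp: paths_avoiding_def\<close>)

lemma sum_paths_avoiding_rec:
  assumes "\<alpha> \<in> V - S"
  shows "(\<Sum>p\<in>paths_avoiding S \<alpha>. f p) =
    f [\<alpha>] + (\<Sum>\<beta>\<in>V - insert \<alpha> S. \<Sum>p\<in>paths_avoiding (insert \<alpha> S) \<beta>. f (\<alpha> # p))"
proof -
  let ?P = "\<Union>\<beta>\<in>V - insert \<alpha> S. paths_avoiding (insert \<alpha> S) \<beta>"
  have "[\<alpha>] \<notin> (#) \<alpha> ` ?P" by (auto simp: paths_avoiding_def)
  then have "(\<Sum>p\<in>paths_avoiding S \<alpha>. f p) = f [\<alpha>] + (\<Sum>p\<in>?P. f (\<alpha> # p))"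
    unfolding paths_avoiding_rec[OF assms]
    by (simp add: finite_V finite_paths_avoiding sum.reindex)
  also have "(\<Sum>p\<in>?P. f (\<alpha> # p)) =
      (\<Sum>\<beta>\<in>V - insert \<alpha> S. \<Sum>p\<in>paths_avoiding (insert \<alpha> S) \<beta>. f (\<alpha> # p))"
    by (rule sum.UNION_disjoint)
      (simp_all add: finite_V finite_paths_avoiding, auto simp: paths_avoiding_def)
  finally show ?thesis .
qed

theorem sum_path_prod_paths_avoiding:
  assumes "S \<subseteq> V" "\<alpha> \<in> V - S"
  shows "(\<Sum>p\<in>paths_avoiding S \<alpha>. path_prod S p) = e \<alpha> - N (insert \<alpha> S) \<star> J \<star> e \<alpha>"
  using assms
proof (induction "card (V - S)" arbitrary: S \<alpha> rule: less_induct)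
  case less
  let ?S = "insert \<alpha> S"
  have S: "?S \<subseteq> V" "card (V - ?S) < card (V - S)"
    using less.prems finite_V by (simp, intro psubset_card_mono, auto)
  have "(\<Sum>p\<in>paths_avoiding ?S \<beta>. path_prod S (\<alpha> # p)) = - (N ?S \<star> e \<beta> \<star> J \<star> e \<alpha>)"
    if \<beta>: "\<beta> \<in> V - ?S" for \<beta>
  proof -
    have "path_prod S (\<alpha> # p) = - (path_prod ?S p \<star> (N ?S \<star> e \<beta> \<star> J \<star> e \<alpha>))"
      if "p \<in> paths_avoiding ?S \<beta>" for p
      using that by (cases p) (auto simp: paths_avoiding_def rng.mult.assoc)
    then have "(\<Sum>p\<in>paths_avoiding ?S \<beta>. path_prod S (\<alpha> # p)) =
        - ((\<Sum>p\<in>paths_avoiding ?S \<beta>. path_prod ?S p) \<star> (N ?S \<star> e \<beta> \<star> J \<star> e \<alpha>))"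
      by (simp add: sum_negf mult_sum_distrib_right)
    also have "\<dots> = - (N ?S \<star> e \<beta> \<star> J \<star> e \<alpha>)"
      using less.hyps[OF S(2) S(1) \<beta>] N_column_elimination[OF S(1) \<beta>]
      by (simp flip: rng.mult.assoc)
    finally show ?thesis .
  qed
  then have "(\<Sum>p\<in>paths_avoiding S \<alpha>. path_prod S p) =
      e \<alpha> - N ?S \<star> unit_outside ?S \<star> J \<star> e \<alpha>"
    by (simp add: sum_paths_avoiding_rec[OF less.prems(2)] unit_outside_def
        mult_sum_distrib_left mult_sum_distrib_right sum_negf)
  then show ?case using N_mult_unit[OF S(1)] by simp
qed

lemma path_prod_append_single:
  assumes "p \<noteq> []" "last p \<in> V"
  shows "path_prod S (p @ [\<delta>]) = - (e \<delta> \<star> N (S \<union> set p) \<star> e \<delta> \<star> J \<star> path_prod S p)"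
  using assms
proof (induction S p rule: path_prod.induct)
  case (3 S \<alpha> \<beta> p)
  then show ?case by (simp add: rng.mult.assoc insert_commute)
qed simp_all

lemma idempotent_mult_path_prod:
  assumes "set p \<subseteq> V" "p \<noteq> []" "\<omega> \<in> V"
  shows "e \<omega> \<star> path_prod S p = (if last p = \<omega> then path_prod S p else 0)"
  using assms
proof (induction S p rule: path_prod.induct)
  case (3 S \<alpha> \<beta> p)
  then have "e \<omega> \<star> path_prod (insert \<alpha> S) (\<beta> # p) =
      (if last (\<beta> # p) = \<omega> then path_prod (insert \<alpha> S) (\<beta> # p) else 0)" by simp
  then show ?case by (simp flip: rng.mult.assoc)
qed (auto simp: idempotent orthogonal)

lemma path_prod_mult_idempotent:
  assumes "p \<noteq> []" "hd p \<in> V"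
  shows "path_prod S p \<star> e (hd p) = path_prod S p"
  using assms by (cases "(S, p)" rule: path_prod.cases) (simp_all add: rng.mult.assoc idempotent)

lemma path_prod_eq_0:
  assumes "set p \<subseteq> V" "\<not> set (vwalk_arcs p) \<subseteq> parcs G"
  shows "path_prod S p = 0"
  using assms
proof (induction S p rule: path_prod.induct)
  case (3 S \<alpha> \<beta> p)
  show ?case
  proof (cases "(\<alpha>, \<beta>) \<in> parcs G")
    case True
    then show ?thesis using 3 by simp
  next
    case False
    then have "e \<beta> \<star> J \<star> e \<alpha> = 0" using 3 by (intro no_arc) auto
    then show ?thesis by (simp add: rng.mult.assoc)
  qed
qed simp_all

lemma simple_paths_eq:
  "simple_paths G \<alpha> \<omega> = {p \<in> paths_avoiding {} \<alpha>. last p = \<omega> \<and> set (vwalk_arcs p) \<subseteq> parcs G}"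
  by (auto simp: simple_paths_def paths_avoiding_def vpath_def vwalk_def)

lemma finite_simple_paths: "finite (simple_paths G \<alpha> \<omega>)"
  by (simp add: simple_paths_eq finite_paths_avoiding)

theorem N_eq_sum_simple_paths:
  assumes "\<alpha> \<in> V" "\<omega> \<in> V"
  shows "e \<omega> \<star> N {} \<star> e \<alpha> = (\<Sum>p\<in>simple_paths G \<alpha> \<omega>. path_prod {} p \<star> N {} \<star> e \<alpha>)"
proof -
  let ?P = "paths_avoiding {} \<alpha>"
  have "e \<omega> \<star> N {} \<star> e \<alpha> = e \<omega> \<star> (\<Sum>p\<in>?P. path_prod {} p) \<star> (N {} \<star> e \<alpha>)"
    using N_column_elimination[of "{}" \<alpha>] sum_path_prod_paths_avoiding[of "{}" \<alpha>] assms
    by (simp add: rng.mult.assoc)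
  also have "\<dots> = (\<Sum>p\<in>?P. e \<omega> \<star> path_prod {} p) \<star> (N {} \<star> e \<alpha>)"
    by (simp only: mult_sum_distrib_left)
  also have "(\<Sum>p\<in>?P. e \<omega> \<star> path_prod {} p) = (\<Sum>p\<in>simple_paths G \<alpha> \<omega>. path_prod {} p)"
  proof (rule sum.mono_neutral_cong_right[OF finite_paths_avoiding])
    show "\<forall>p\<in>?P - simple_paths G \<alpha> \<omega>. e \<omega> \<star> path_prod {} p = 0"
      using assms
      by (simp add: simple_paths_eq paths_avoiding_def idempotent_mult_path_prod)
        (blast intro: path_prod_eq_0)
  qed (use assms in \<open>auto simp: simple_paths_eq paths_avoiding_def idempotent_mult_path_prod\<close>)
  finally show ?thesis by (simp add: mult_sum_distrib_right rng.mult.assoc)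
qed

lemma vwalk_arcs_append_single:
  "p \<noteq> [] \<Longrightarrow> set (vwalk_arcs (p @ [\<beta>])) = insert (last p, \<beta>) (set (vwalk_arcs p))"
  by (induction p rule: vwalk_arcs.induct) auto

lemma simple_cycles_eq:
  assumes "\<alpha> \<in> V"
  shows "simple_cycles G \<alpha> = (\<lambda>p. p @ [\<alpha>]) `
    {p \<in> paths_avoiding {} \<alpha>. set (vwalk_arcs (p @ [\<alpha>])) \<subseteq> parcs G}" (is "_ = ?close ` ?P")
proof (intro equalityI subsetI)
  fix c assume c: "c \<in> simple_cycles G \<alpha>"
  then have "tl c \<noteq> []" by (cases c) (auto simp: simple_cycles_def)
  then have "c = (\<alpha> # butlast (tl c)) @ [\<alpha>]"
    using c append_butlast_last_id[of "tl c"] by (cases c) (auto simp: simple_cycles_def)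
  then obtain q where q: "c = (\<alpha> # q) @ [\<alpha>]" by blast
  then have "\<alpha> # q \<in> ?P"
    using c by (auto simp: simple_cycles_def paths_avoiding_def vwalk_def)
  then show "c \<in> ?close ` ?P" using q by blast
next
  fix c assume "c \<in> ?close ` ?P"
  then obtain p where p: "p \<in> ?P" "c = p @ [\<alpha>]" by blast
  then obtain q where "p = \<alpha> # q" by (cases p) (auto simp: paths_avoiding_def)
  then show "c \<in> simple_cycles G \<alpha>"
    using p assms by (auto simp: simple_cycles_def paths_avoiding_def vwalk_def butlast_append)
qed

lemma finite_simple_cycles: "\<alpha> \<in> V \<Longrightarrow> finite (simple_cycles G \<alpha>)"
  by (simp add: simple_cycles_eq finite_paths_avoiding)

lemma idempotent_mult_J_mult_path_prod_eq_0:
  assumes "\<alpha> \<in> V" "p \<noteq> []" "set p \<subseteq> V" "\<not> set (vwalk_arcs (p @ [\<alpha>])) \<subseteq> parcs G"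
  shows "e \<alpha> \<star> J \<star> path_prod S p = 0"
proof (cases "(last p, \<alpha>) \<in> parcs G")
  case True
  then have "path_prod S p = 0"
    using assms by (intro path_prod_eq_0) (auto simp: vwalk_arcs_append_single)
  then show ?thesis by simp
next
  case False
  have last_V: "last p \<in> V" using assms(2,3) last_in_set by blast
  then have "e \<alpha> \<star> J \<star> path_prod S p = e \<alpha> \<star> J \<star> (e (last p) \<star> path_prod S p)"
    using assms(2,3) by (simp add: idempotent_mult_path_prod)
  also have "\<dots> = 0" using no_arc[OF last_V assms(1) False] by (simp flip: rng.mult.assoc)
  finally show ?thesis .
qed

theorem sum_simple_cycles:
  assumes "\<alpha> \<in> V"
  shows "(\<Sum>c\<in>simple_cycles G \<alpha>. e \<alpha> \<star> J \<star> path_prod {} (butlast c)) =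
    e \<alpha> \<star> J \<star> (e \<alpha> - N {\<alpha>} \<star> J \<star> e \<alpha>)"
proof -
  let ?P = "paths_avoiding {} \<alpha>"
  let ?Q = "{p \<in> ?P. set (vwalk_arcs (p @ [\<alpha>])) \<subseteq> parcs G}"
  have "(\<Sum>c\<in>simple_cycles G \<alpha>. e \<alpha> \<star> J \<star> path_prod {} (butlast c)) =
      (\<Sum>p\<in>?Q. e \<alpha> \<star> J \<star> path_prod {} p)"
    unfolding simple_cycles_eq[OF assms] by (simp add: sum.reindex inj_on_def)
  also have "\<dots> = (\<Sum>p\<in>?P. e \<alpha> \<star> J \<star> path_prod {} p)"
  proof (rule sum.mono_neutral_left[OF finite_paths_avoiding])
    show "\<forall>p\<in>?P - ?Q. e \<alpha> \<star> J \<star> path_prod {} p = 0"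
      using idempotent_mult_J_mult_path_prod_eq_0[OF assms] by (auto simp: paths_avoiding_def)
  qed auto
  also have "\<dots> = e \<alpha> \<star> J \<star> (\<Sum>p\<in>?P. path_prod {} p)"
    by (simp only: mult_sum_distrib_left)
  finally show ?thesis using sum_path_prod_paths_avoiding[of "{}" \<alpha>] assms by simp
qed

theorem sum_simple_cycles_mult_N:
  assumes "\<alpha> \<in> V"
  shows "(\<Sum>c\<in>simple_cycles G \<alpha>. e \<alpha> \<star> J \<star> path_prod {} (butlast c)) \<star>
    (e \<alpha> \<star> N {} \<star> e \<alpha>) = e \<alpha>"
proof -
  let ?D = "e \<alpha> - N {\<alpha>} \<star> J \<star> e \<alpha>"
  have "?D \<star> e \<alpha> = ?D"
    using assms by (simp add: rng.left_diff_distrib rng.mult.assoc idempotent)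
  then have "e \<alpha> \<star> J \<star> ?D \<star> (e \<alpha> \<star> N {} \<star> e \<alpha>) = e \<alpha> \<star> J \<star> ?D \<star> N {} \<star> e \<alpha>"
    by (metis rng.mult.assoc)
  also have "\<dots> = e \<alpha>" using schur_complement_mult_N[of "{}" \<alpha>] assms by simp
  finally show ?thesis by (simp only: sum_simple_cycles[OF assms])
qed

end

section \<open>The ring of kernels on a finite index set\<close>

definition kernel_mult ::
    "'i set \<Rightarrow> ('i \<Rightarrow> 'i \<Rightarrow> 'a :: ring) \<Rightarrow> ('i \<Rightarrow> 'i \<Rightarrow> 'a) \<Rightarrow> 'i \<Rightarrow> 'i \<Rightarrow> 'a" where
  "kernel_mult U f g = (\<lambda>i j. \<Sum>k\<in>U. f i k * g k j)"

definition kernel_unit :: "'i set \<Rightarrow> 'i \<Rightarrow> 'i \<Rightarrow> 'a :: ring_1" where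
  "kernel_unit X = (\<lambda>i j. of_bool (i = j \<and> i \<in> X))"

lemma rng_product_kernel_mult:
  "rng_product (kernel_mult U :: ('i \<Rightarrow> 'i \<Rightarrow> 'a :: ring) \<Rightarrow> _)"
proof unfold_locales
  fix f g h :: "'i \<Rightarrow> 'i \<Rightarrow> 'a"
  show "kernel_mult U (kernel_mult U f g) h = kernel_mult U f (kernel_mult U g h)"
    unfolding kernel_mult_def sum_distrib_left sum_distrib_right
    by (subst sum.swap) (simp add: mult.assoc)
  show "kernel_mult U (f + g) h = kernel_mult U f h + kernel_mult U g h"
    "kernel_mult U f (g + h) = kernel_mult U f g + kernel_mult U f h"
    by (simp_all add: kernel_mult_def fun_eq_iff distrib_left distrib_right sum.distrib)
qed

lemma kernel_unit_empty: "kernel_unit {} = 0"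
  by (simp add: kernel_unit_def fun_eq_iff)

lemma kernel_unit_UN:
  assumes "finite A" "disjoint_family_on I A"
  shows "kernel_unit (\<Union>\<beta>\<in>A. I \<beta>) = (\<Sum>\<beta>\<in>A. kernel_unit (I \<beta>))"
  using assms
proof (induction A rule: finite_induct)
  case empty
  show ?case by (simp add: kernel_unit_empty)
next
  case (insert \<beta> A)
  then have "I \<beta> \<inter> (\<Union>\<gamma>\<in>A. I \<gamma>) = {}" "disjoint_family_on I A"
    by (auto simp: disjoint_family_on_def)
  moreover have "kernel_unit (X \<union> Y) = kernel_unit X + kernel_unit Y" if "X \<inter> Y = {}" for X Y
    using that by (auto simp: kernel_unit_def fun_eq_iff)
  ultimately show ?case
    unfolding sum.insert[OF insert.hyps] UN_insert using insert.IH by metis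
qed

lemma mat_on_kernel_unit: "mat_on X X (kernel_unit X) = 1\<^sub>m (card X)"
  unfolding mat_on_of_bool_eq[symmetric] by (rule mat_on_cong) (simp add: kernel_unit_def)

definition kernel_of_mat :: "nat set \<Rightarrow> 'a :: zero mat \<Rightarrow> nat \<Rightarrow> nat \<Rightarrow> 'a" where
  "kernel_of_mat R A i j =
    (if i \<in> R \<and> j \<in> R then A $$ (rank_in R i, rank_in R j) else 0)"

lemma mat_on_kernel_of_mat:
  "A \<in> carrier_mat (card R) (card R) \<Longrightarrow> mat_on R R (kernel_of_mat R A) = A"
  using mat_on_rank_in[of A R R] mat_on_cong[of R R "kernel_of_mat R A"]
  by (simp add: kernel_of_mat_def)

locale finite_index_set =
  fixes U :: "nat set"
  assumes finite_U: "finite U"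
begin

abbreviation kernel_mult_on ::
    "(nat \<Rightarrow> nat \<Rightarrow> 'a :: ring) \<Rightarrow> (nat \<Rightarrow> nat \<Rightarrow> 'a) \<Rightarrow> nat \<Rightarrow> nat \<Rightarrow> 'a" (infixl "\<star>" 70) where
  "f \<star> g \<equiv> kernel_mult U f g"

lemma kernel_unit_mult:
  assumes "X \<subseteq> U"
  shows "kernel_unit X \<star> f = (\<lambda>i j. if i \<in> X then f i j else 0)"
proof (intro ext)
  fix i j
  have "(\<Sum>k\<in>U. of_bool (i = k \<and> i \<in> X) * f k j) =
      (\<Sum>k\<in>U. if k = i then if i \<in> X then f i j else 0 else 0)"
    by (rule sum.cong) auto
  then show "(kernel_unit X \<star> f) i j = (if i \<in> X then f i j else 0)"
    using assms finite_U by (auto simp: kernel_mult_def kernel_unit_def)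
qed

lemma mult_kernel_unit:
  assumes "X \<subseteq> U"
  shows "f \<star> kernel_unit X = (\<lambda>i j. if j \<in> X then f i j else 0)"
proof (intro ext)
  fix i j
  have "(\<Sum>k\<in>U. f i k * of_bool (k = j \<and> k \<in> X)) =
      (\<Sum>k\<in>U. if k = j then if j \<in> X then f i j else 0 else 0)"
    by (rule sum.cong) auto
  then show "(f \<star> kernel_unit X) i j = (if j \<in> X then f i j else 0)"
    using assms finite_U by (auto simp: kernel_mult_def kernel_unit_def)
qed

lemma kernel_unit_mult_kernel_unit:
  "X \<subseteq> U \<Longrightarrow> kernel_unit X \<star> kernel_unit Y = kernel_unit (X \<inter> Y)"
  by (simp add: kernel_unit_mult) (auto simp: kernel_unit_def fun_eq_iff)

lemma mat_on_kernel_unit_mult: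
  "X \<subseteq> U \<Longrightarrow> mat_on X Y (kernel_unit X \<star> f) = mat_on X Y f"
  by (rule mat_on_cong) (simp add: kernel_unit_mult)

lemma mat_on_mult_kernel_unit:
  "Y \<subseteq> U \<Longrightarrow> mat_on X Y (f \<star> kernel_unit Y) = mat_on X Y f"
  by (rule mat_on_cong) (simp add: mult_kernel_unit)

lemma mat_on_mult_kernel:
  assumes "K \<subseteq> U"
  shows "mat_on X K f * mat_on K Y g = mat_on X Y (f \<star> kernel_unit K \<star> g)"
proof -
  have "(\<Sum>k\<in>K. f i k * g k j) = (\<Sum>k\<in>U. (if k \<in> K then f i k else 0) * g k j)" for i j
    using assms finite_U by (intro sum.mono_neutral_cong_left) auto
  then show ?thesis
    unfolding mat_on_mult[OF finite_subset[OF assms finite_U]] mult_kernel_unit[OF assms]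
    by (simp add: kernel_mult_def)
qed

lemma mat_on_eqD:
  assumes "mat_on X Y f = mat_on X Y g" and XY: "X \<subseteq> U" "Y \<subseteq> U"
  shows "kernel_unit X \<star> f \<star> kernel_unit Y = kernel_unit X \<star> g \<star> kernel_unit Y"
proof -
  have "f i j = g i j" if "i \<in> X" "j \<in> Y" for i j
    using mat_on_index[of X Y i j f] mat_on_index[of X Y i j g] assms that finite_U
    by (simp add: finite_subset)
  then show ?thesis
    by (auto simp: kernel_unit_mult[OF XY(1)] mult_kernel_unit[OF XY(2)] fun_eq_iff)
qed

lemma kernel_mult_eq_unit_if_mat_on_mult_eq_one:
  fixes f g :: "nat \<Rightarrow> nat \<Rightarrow> 'a :: ring_1"
  assumes "mat_on R R f * mat_on R R g = 1\<^sub>m (card R)" and R: "R \<subseteq> U"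
  shows "kernel_unit R \<star> f \<star> kernel_unit R \<star> g \<star> kernel_unit R = kernel_unit R"
proof -
  interpret rng_product "kernel_mult U :: (nat \<Rightarrow> nat \<Rightarrow> 'a) \<Rightarrow> _" by (rule rng_product_kernel_mult)
  have "mat_on R R (f \<star> kernel_unit R \<star> g) = mat_on R R (kernel_unit R)"
    using assms(1) by (simp add: mat_on_mult_kernel[OF R] mat_on_kernel_unit)
  from mat_on_eqD[OF this R R] show ?thesis
    using R by (simp add: kernel_unit_mult_kernel_unit flip: rng.mult.assoc)
qed

lemma kernel_unit_mult_kernel_of_mat:
  "R \<subseteq> U \<Longrightarrow> kernel_unit R \<star> kernel_of_mat R A = kernel_of_mat R A"
  by (simp add: kernel_unit_mult kernel_of_mat_def fun_eq_iff)

lemma kernel_of_mat_mult_kernel_unit: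
  "R \<subseteq> U \<Longrightarrow> kernel_of_mat R A \<star> kernel_unit R = kernel_of_mat R A"
  by (simp add: mult_kernel_unit kernel_of_mat_def fun_eq_iff)

end

section \<open>Block matrices\<close>

locale partitioned_matrix =
  fixes J :: "real mat" and n B :: nat and I :: "nat \<Rightarrow> nat set"
  assumes J_carrier: "J \<in> carrier_mat n n"
    and det_principal_submatrix: "R \<subseteq> {..<n} \<Longrightarrow> det (submatrix J R R) \<noteq> 0"
    and partition: "index_partition n B I"
begin

sublocale finite_index_set "{..<n}"
  by standard simp

notation kernel_mult_on (infixl "\<star>" 70)

abbreviation rest :: "nat set \<Rightarrow> nat set" where
  "rest S \<equiv> remaining_indices n I S"

abbreviation G :: "nat pair_pre_digraph" where
  "G \<equiv> block_graph B J I"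

abbreviation e :: "nat \<Rightarrow> nat \<Rightarrow> nat \<Rightarrow> real" where
  "e \<beta> \<equiv> kernel_unit (I \<beta>)"

abbreviation J_kernel :: "nat \<Rightarrow> nat \<Rightarrow> real" where
  "J_kernel \<equiv> \<lambda>i j. J $$ (i, j)"

definition N :: "nat set \<Rightarrow> nat \<Rightarrow> nat \<Rightarrow> real" where
  "N S = kernel_of_mat (rest S) (mat_inv (delete_blocks J I S))"

lemma pverts_G: "pverts G = {1..B}"
  by (simp add: block_graph_def)

lemma I_subset: "\<beta> \<in> pverts G \<Longrightarrow> I \<beta> \<subseteq> {..<n}"
  using partition unfolding index_partition_def pverts_G by blast

lemma disjoint_I: "disjoint_family_on I (pverts G)"
  using partition unfolding index_partition_def pverts_G by blast

lemma rest_subset: "rest S \<subseteq> {..<n}"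
  by (auto simp: remaining_indices_def)

lemma rest_eq_UN:
  assumes "S \<subseteq> pverts G"
  shows "rest S = (\<Union>\<beta>\<in>pverts G - S. I \<beta>)"
proof -
  have indices: "{..<n} = (\<Union>\<beta>\<in>pverts G. I \<beta>)"
    using partition by (simp add: index_partition_def pverts_G)
  have "I \<beta> \<inter> I \<gamma> = {}" if "\<beta> \<in> pverts G - S" "\<gamma> \<in> S" for \<beta> \<gamma>
    using disjoint_family_onD[OF disjoint_I, of \<beta> \<gamma>] assms that by blast
  then show ?thesis unfolding remaining_indices_def indices by fast
qed

sublocale orthogonal_idempotents "(\<star>)" "pverts G" e
proof -
  interpret rng_product "(\<star>)" by (rule rng_product_kernel_mult)
  show "orthogonal_idempotents (\<star>) (pverts G) e"
  proof
    show "finite (pverts G)" by (simp add: pverts_G)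
    show "e \<beta> \<star> e \<beta> = e \<beta>" if "\<beta> \<in> pverts G" for \<beta>
      using I_subset[OF that] by (simp add: kernel_unit_mult_kernel_unit)
    show "e \<beta> \<star> e \<gamma> = 0" if "\<beta> \<in> pverts G" "\<gamma> \<in> pverts G" "\<beta> \<noteq> \<gamma>" for \<beta> \<gamma>
      using I_subset[OF that(1)] disjoint_family_onD[OF disjoint_I that]
      by (simp add: kernel_unit_mult_kernel_unit kernel_unit_empty)
  qed
qed

lemma unit_outside_eq: "S \<subseteq> pverts G \<Longrightarrow> unit_outside S = kernel_unit (rest S)"
  unfolding unit_outside_def rest_eq_UN
  by (rule kernel_unit_UN[symmetric])
    (use finite_V disjoint_I in \<open>auto simp: disjoint_family_on_def\<close>)

lemma block_J:
  "\<beta> \<in> pverts G \<Longrightarrow> \<alpha> \<in> pverts G \<Longrightarrow> block J I \<beta> \<alpha> = mat_on (I \<beta>) (I \<alpha>) J_kernel"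
  unfolding block_def by (intro submatrix_eq_mat_on[OF J_carrier] I_subset)

lemma delete_blocks_eq: "delete_blocks J I S = mat_on (rest S) (rest S) J_kernel"
  using submatrix_eq_mat_on[OF J_carrier rest_subset rest_subset] J_carrier
  by (simp add: delete_blocks_def Let_def)

lemma det_delete_blocks: "det (delete_blocks J I S) \<noteq> 0"
  using det_principal_submatrix[OF rest_subset] J_carrier by (simp add: delete_blocks_def Let_def)

lemma delete_blocks_carrier: "delete_blocks J I S \<in> carrier_mat (card (rest S)) (card (rest S))"
  by (simp add: delete_blocks_eq)

lemma mat_inv_delete_blocks_carrier:
  "mat_inv (delete_blocks J I S) \<in> carrier_mat (card (rest S)) (card (rest S))"
  by (rule mat_inv_carrier[OF delete_blocks_carrier det_delete_blocks])

lemma mat_on_N: "mat_on (rest S) (rest S) (N S) = mat_inv (delete_blocks J I S)"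
  unfolding N_def by (rule mat_on_kernel_of_mat[OF mat_inv_delete_blocks_carrier])

sublocale deleted_inverses "(\<star>)" G e J_kernel N
proof
  fix S assume S: "S \<subseteq> pverts G"
  let ?u = "kernel_unit (rest S) :: nat \<Rightarrow> nat \<Rightarrow> real"
  note unit = unit_outside_eq[OF S]
  show unit_N: "unit_outside S \<star> N S = N S" and N_unit: "N S \<star> unit_outside S = N S"
    unfolding unit N_def
    by (rule kernel_unit_mult_kernel_of_mat[OF rest_subset]
        kernel_of_mat_mult_kernel_unit[OF rest_subset])+
  have "?u \<star> J_kernel \<star> ?u \<star> N S \<star> ?u = ?u" "?u \<star> N S \<star> ?u \<star> J_kernel \<star> ?u = ?u"
    using mult_mat_inv[OF delete_blocks_carrier det_delete_blocks]
      mat_inv_mult[OF delete_blocks_carrier det_delete_blocks]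
    by (intro kernel_mult_eq_unit_if_mat_on_mult_eq_one rest_subset;
        simp add: mat_on_N flip: delete_blocks_eq)+
  then show "unit_outside S \<star> J_kernel \<star> N S = unit_outside S"
    "N S \<star> J_kernel \<star> unit_outside S = unit_outside S"
    using unit_N N_unit unfolding unit by (metis rng.mult.assoc)+
next
  fix \<beta> \<gamma> assume \<beta>\<gamma>: "\<beta> \<in> pverts G" "\<gamma> \<in> pverts G" "(\<beta>, \<gamma>) \<notin> parcs G"
  then have "mat_on (I \<gamma>) (I \<beta>) J_kernel = mat_on (I \<gamma>) (I \<beta>) 0"
    by (simp add: mat_on_zero block_J[symmetric] block_graph_def)
  from mat_on_eqD[OF this I_subset[OF \<beta>\<gamma>(2)] I_subset[OF \<beta>\<gamma>(1)]]
  show "e \<gamma> \<star> J_kernel \<star> e \<beta> = 0" by simp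
qed

lemma mat_on_blocks_mult:
  "\<beta> \<in> V \<Longrightarrow> mat_on X (I \<beta>) f * mat_on (I \<beta>) Y g = mat_on X Y (f \<star> e \<beta> \<star> g)"
  using I_subset by (intro mat_on_mult_kernel) auto

lemma mat_on_idempotent_mult: "\<beta> \<in> V \<Longrightarrow> mat_on (I \<beta>) Y (e \<beta> \<star> f) = mat_on (I \<beta>) Y f"
  using I_subset by (intro mat_on_kernel_unit_mult) auto

lemma mat_on_mult_idempotent: "\<beta> \<in> V \<Longrightarrow> mat_on X (I \<beta>) (f \<star> e \<beta>) = mat_on X (I \<beta>) f"
  using I_subset by (intro mat_on_mult_kernel_unit) auto

lemma deleted_inv_block_eq:
  assumes "S \<subseteq> V" "\<nu> \<in> V - S"
  shows "deleted_inv_block J I S \<nu> = mat_on (I \<nu>) (I \<nu>) (N S)"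
proof -
  have sub: "I \<nu> \<subseteq> rest S" using assms rest_eq_UN by auto
  have fin: "finite (rest S)" using rest_subset finite_subset by blast
  have "deleted_inv_block J I S \<nu> = mat_on (I \<nu>) (I \<nu>)
      (\<lambda>i j. mat_inv (delete_blocks J I S) $$ (rank_in (rest S) i, rank_in (rest S) j))"
    using submatrix_image_rank_in[OF mat_inv_delete_blocks_carrier fin fin sub sub] J_carrier
    by (simp add: deleted_inv_block_def Let_def rank_in_def)
  also have "\<dots> = mat_on (I \<nu>) (I \<nu>) (N S)"
    using sub by (intro mat_on_cong) (auto simp: N_def kernel_of_mat_def)
  finally show ?thesis .
qed

lemma block_mat_inv:
  assumes "\<beta> \<in> V" "\<alpha> \<in> V"
  shows "block (mat_inv J) I \<beta> \<alpha> = mat_on (I \<beta>) (I \<alpha>) (N {})"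
proof -
  have rest: "rest {} = {..<n}" by (simp add: remaining_indices_def)
  have J: "delete_blocks J I {} = J"
    by (simp add: delete_blocks_eq rest mat_on_lessThan[OF J_carrier])
  have "mat_inv J \<in> carrier_mat n n"
    using mat_inv_delete_blocks_carrier[of "{}"] by (simp add: J rest)
  then have "block (mat_inv J) I \<beta> \<alpha> = mat_on (I \<beta>) (I \<alpha>) (\<lambda>i j. mat_inv J $$ (i, j))"
    unfolding block_def using assms I_subset by (intro submatrix_eq_mat_on)
  also have "\<dots> = mat_on (I \<beta>) (I \<alpha>) (N {})"
    using assms I_subset
    by (intro mat_on_cong) (auto simp: N_def kernel_of_mat_def rest J rank_in_lessThan subset_eq)
  finally show ?thesis .
qed

lemma walk_factor_eq:
  assumes "set p \<subseteq> V" "distinct (take (Suc j) p)" "j < length p"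
  shows "walk_factor J I p j =
    mat_on (I (p ! j)) (I (p ! (j - 1))) (N (set (take j p)) \<star> e (p ! j) \<star> J_kernel)"
proof -
  have "p ! j \<in> V" "p ! (j - 1) \<in> V" "set (take j p) \<subseteq> V"
    using subsetD[OF assms(1) nth_mem] assms(3) subset_trans[OF set_take_subset assms(1)]
    by (simp_all only: less_imp_diff_less)
  moreover have "p ! j \<notin> set (take j p)"
    using assms by (simp add: take_Suc_conv_app_nth)
  ultimately show ?thesis
    unfolding walk_factor_def by (simp add: deleted_inv_block_eq block_J mat_on_blocks_mult)
qed

lemma prod_right_to_left_walk_factor:
  assumes p: "set p \<subseteq> V" "hd p = \<alpha>" and "m < length p" "distinct (take (Suc m) p)"
  shows "prod_right_to_left (card (I \<alpha>)) (walk_factor J I p) m =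
    (-1) ^ m \<cdot>\<^sub>m mat_on (I (p ! m)) (I \<alpha>) (path_prod {} (take (Suc m) p))"
  using assms(3,4)
proof (induction m)
  case 0
  then have "p ! 0 = \<alpha>" "take (Suc 0) p = [\<alpha>]" using p(2) by (cases p; simp)+
  then show ?case by (simp add: mat_on_kernel_unit one_smult_mat)
next
  case (Suc m)
  let ?\<gamma> = "p ! m" and ?\<delta> = "p ! Suc m" and ?q = "take (Suc m) p"
  let ?F = "N (set ?q) \<star> e ?\<delta> \<star> J_kernel" and ?P = "path_prod {} ?q"
  have take: "take (Suc (Suc m)) p = ?q @ [?\<delta>]"
    by (rule take_Suc_conv_app_nth[OF Suc.prems(1)])
  have q: "?q \<noteq> []" "set ?q \<subseteq> V" "last ?q = ?\<gamma>" "distinct ?q"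
    using Suc.prems p(1) set_take_subset[of "Suc m" p] unfolding take
    by (auto simp: take_Suc_conv_app_nth)
  have V: "?\<gamma> \<in> V" "?\<delta> \<in> V" using Suc.prems(1) p(1) by (auto dest: nth_mem)
  have "prod_right_to_left (card (I \<alpha>)) (walk_factor J I p) (Suc m) =
      mat_on (I ?\<delta>) (I ?\<gamma>) ?F * ((-1) ^ m \<cdot>\<^sub>m mat_on (I ?\<gamma>) (I \<alpha>) ?P)"
    using Suc q(4) by (simp add: walk_factor_eq[OF p(1)])
  also have "\<dots> = (-1) ^ m \<cdot>\<^sub>m (mat_on (I ?\<delta>) (I ?\<gamma>) ?F * mat_on (I ?\<gamma>) (I \<alpha>) ?P)"
    by (rule mult_smult_distrib[OF mat_on_carrier mat_on_carrier])
  also have "mat_on (I ?\<delta>) (I ?\<gamma>) ?F * mat_on (I ?\<gamma>) (I \<alpha>) ?P = mat_on (I ?\<delta>) (I \<alpha>) (?F \<star> ?P)"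
    using q V by (simp add: mat_on_blocks_mult rng.mult.assoc idempotent_mult_path_prod)
  also have "\<dots> = mat_on (I ?\<delta>) (I \<alpha>) (e ?\<delta> \<star> ?F \<star> ?P)"
    using V by (simp add: mat_on_idempotent_mult rng.mult.assoc)
  also have "\<dots> = - mat_on (I ?\<delta>) (I \<alpha>) (path_prod {} (take (Suc (Suc m)) p))"
    unfolding take using q V
    by (simp add: path_prod_append_single rng.mult.assoc flip: mat_on_uminus)
  finally show ?case by (auto intro!: eq_matI)
qed

lemma path_term_eq:
  assumes "p \<in> simple_paths G \<alpha> \<omega>"
  shows "path_term J I p = mat_on (I \<omega>) (I \<alpha>) (path_prod {} p \<star> N {} \<star> e \<alpha>)"
proof -
  let ?P = "mat_on (I \<omega>) (I \<alpha>) (path_prod {} p)" and ?N = "mat_on (I \<alpha>) (I \<alpha>) (N {})"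
  have p: "p \<noteq> []" "distinct p" "set p \<subseteq> V" "hd p = \<alpha>" "last p = \<omega>"
    using assms by (auto simp: simple_paths_def vpath_def vwalk_def)
  then have \<alpha>: "\<alpha> \<in> V" using hd_in_set by blast
  obtain m where m: "length p = Suc m" using p(1) by (cases p) auto
  then have nth: "p ! m = \<omega>" using p by (simp add: last_conv_nth)
  have "path_term J I p = (-1) ^ m \<cdot>\<^sub>m (((-1) ^ m \<cdot>\<^sub>m ?P) * ?N)"
    using prod_right_to_left_walk_factor[OF p(3,4), of m] p m nth
    by (simp add: path_term_def block_mat_inv \<alpha>)
  also have "((-1) ^ m \<cdot>\<^sub>m ?P) * ?N = (-1) ^ m \<cdot>\<^sub>m (?P * ?N)"
    by (rule mult_smult_assoc_mat[OF mat_on_carrier mat_on_carrier])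
  also have "(-1) ^ m \<cdot>\<^sub>m ((-1) ^ m \<cdot>\<^sub>m (?P * ?N)) = ?P * ?N"
    by (simp add: smult_smult_mat one_smult_mat flip: power_mult_distrib)
  also have "\<dots> = mat_on (I \<omega>) (I \<alpha>) (path_prod {} p \<star> N {})"
    using path_prod_mult_idempotent[of p "{}"] p \<alpha> by (simp add: mat_on_blocks_mult)
  also have "\<dots> = mat_on (I \<omega>) (I \<alpha>) (path_prod {} p \<star> N {} \<star> e \<alpha>)"
    using \<alpha> by (simp add: mat_on_mult_idempotent)
  finally show ?thesis .
qed

lemma cycle_term_eq:
  assumes "c \<in> simple_cycles G \<alpha>"
  shows "cycle_term J I c = mat_on (I \<alpha>) (I \<alpha>) (e \<alpha> \<star> J_kernel \<star> path_prod {} (butlast c))"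
proof -
  have \<alpha>: "\<alpha> \<in> V" using assms by (auto simp: simple_cycles_def vwalk_def)
  obtain p where c: "c = p @ [\<alpha>]" and "p \<in> paths_avoiding {} \<alpha>"
    using assms simple_cycles_eq[OF \<alpha>] by blast
  then have p: "p \<noteq> []" "distinct p" "set p \<subseteq> V" "hd p = \<alpha>" "last p \<in> V"
    using last_in_set by (auto simp: paths_avoiding_def)
  obtain m where m: "length p = Suc m" using p(1) by (cases p) auto
  then have nth: "c ! m = last p" using p by (simp add: c last_conv_nth nth_append)
  let ?J = "mat_on (I \<alpha>) (I (last p)) J_kernel"
    and ?P = "mat_on (I (last p)) (I \<alpha>) (path_prod {} p)"
  have "set c \<subseteq> V" "hd c = \<alpha>" using p \<alpha> by (simp_all add: c)
  then have "prod_right_to_left (card (I \<alpha>)) (walk_factor J I c) m = (-1) ^ m \<cdot>\<^sub>m ?P"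
    using prod_right_to_left_walk_factor[of c \<alpha> m] p m nth by (simp add: c)
  then have "cycle_term J I c = (-1) ^ m \<cdot>\<^sub>m (?J * ((-1) ^ m \<cdot>\<^sub>m ?P))"
    using p(5) m nth \<open>hd c = \<alpha>\<close> by (simp add: cycle_term_def c block_J \<alpha>)
  also have "?J * ((-1) ^ m \<cdot>\<^sub>m ?P) = (-1) ^ m \<cdot>\<^sub>m (?J * ?P)"
    by (rule mult_smult_distrib[OF mat_on_carrier mat_on_carrier])
  also have "(-1) ^ m \<cdot>\<^sub>m ((-1) ^ m \<cdot>\<^sub>m (?J * ?P)) = ?J * ?P"
    by (simp add: smult_smult_mat one_smult_mat flip: power_mult_distrib)
  also have "\<dots> = mat_on (I \<alpha>) (I \<alpha>) (J_kernel \<star> path_prod {} p)"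
    using p by (simp add: mat_on_blocks_mult rng.mult.assoc idempotent_mult_path_prod)
  also have "\<dots> = mat_on (I \<alpha>) (I \<alpha>) (e \<alpha> \<star> J_kernel \<star> path_prod {} p)"
    using \<alpha> by (simp add: mat_on_idempotent_mult rng.mult.assoc)
  finally show ?thesis by (simp add: c)
qed

theorem path_sum:
  assumes "\<alpha> \<in> V" "\<omega> \<in> V"
  shows "block (mat_inv J) I \<omega> \<alpha> =
    finsum_mat TYPE(real) (card (I \<omega>)) (card (I \<alpha>)) (path_term J I) (simple_paths G \<alpha> \<omega>)"
proof -
  have "block (mat_inv J) I \<omega> \<alpha> = mat_on (I \<omega>) (I \<alpha>) (e \<omega> \<star> N {} \<star> e \<alpha>)"
    using assms
    by (simp add: block_mat_inv mat_on_mult_idempotent mat_on_idempotent_mult)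
  also have "\<dots> = mat_on (I \<omega>) (I \<alpha>) (\<Sum>p\<in>simple_paths G \<alpha> \<omega>. path_prod {} p \<star> N {} \<star> e \<alpha>)"
    by (simp only: N_eq_sum_simple_paths[OF assms])
  also have "\<dots> =
      finsum_mat TYPE(real) (card (I \<omega>)) (card (I \<alpha>)) (path_term J I) (simple_paths G \<alpha> \<omega>)"
    by (rule finsum_mat_mat_on[OF finite_simple_paths path_term_eq, symmetric])
  finally show ?thesis .
qed

theorem
  assumes "\<alpha> \<in> V"
  defines "C \<equiv> finsum_mat TYPE(real) (card (I \<alpha>)) (card (I \<alpha>)) (cycle_term J I) (simple_cycles G \<alpha>)"
  shows cycle_sum_carrier: "C \<in> carrier_mat (card (I \<alpha>)) (card (I \<alpha>))"
    and cycle_sum_mult_block_inv: "C * block (mat_inv J) I \<alpha> \<alpha> = 1\<^sub>m (card (I \<alpha>))"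
proof -
  let ?c = "\<Sum>c\<in>simple_cycles G \<alpha>. e \<alpha> \<star> J_kernel \<star> path_prod {} (butlast c)"
  have C: "C = mat_on (I \<alpha>) (I \<alpha>) ?c"
    unfolding C_def using assms(1) by (intro finsum_mat_mat_on finite_simple_cycles cycle_term_eq)
  show "C \<in> carrier_mat (card (I \<alpha>)) (card (I \<alpha>))" by (simp add: C)
  have "C * block (mat_inv J) I \<alpha> \<alpha> = mat_on (I \<alpha>) (I \<alpha>) (?c \<star> e \<alpha> \<star> N {})"
    using assms(1) by (simp add: C block_mat_inv mat_on_blocks_mult)
  also have "\<dots> = mat_on (I \<alpha>) (I \<alpha>) (?c \<star> (e \<alpha> \<star> N {} \<star> e \<alpha>))"
    using mat_on_mult_idempotent[OF assms(1), of "I \<alpha>" "?c \<star> e \<alpha> \<star> N {}"]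
    by (simp only: rng.mult.assoc)
  also have "\<dots> = 1\<^sub>m (card (I \<alpha>))"
    by (simp only: sum_simple_cycles_mult_N[OF assms(1)] mat_on_kernel_unit)
  finally show "C * block (mat_inv J) I \<alpha> \<alpha> = 1\<^sub>m (card (I \<alpha>))" .
qed

end

theorem mainTheorem2:
  fixes J :: "real mat" and n B :: nat and I :: "nat \<Rightarrow> nat set" and \<alpha> \<omega> :: nat
  defines "G \<equiv> block_graph B J I"
  defines "C \<equiv> finsum_mat TYPE(real) (card (I \<alpha>)) (card (I \<alpha>)) (cycle_term J I) (simple_cycles G \<alpha>)"
  assumes "information_matrix n J"
    and "1 \<le> B" and "B \<le> n"
    and "index_partition n B I"
    and "\<alpha> \<in> {1..B}" and "\<omega> \<in> {1..B}"
  shows "block (mat_inv J) I \<omega> \<alpha> =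
           finsum_mat TYPE(real) (card (I \<omega>)) (card (I \<alpha>)) (path_term J I) (simple_paths G \<alpha> \<omega>)
         \<and> invertible_mat C
         \<and> block (mat_inv J) I \<alpha> \<alpha> = mat_inv C"
proof -
  interpret P: partitioned_matrix J n B I
  proof
    show "J \<in> carrier_mat n n" using assms(3) by (simp add: information_matrix_def)
    show "det (submatrix J R R) \<noteq> 0" if "R \<subseteq> {..<n}" for R
      by (rule information_matrix_det_nonzero[OF information_matrix_submatrix[OF assms(3) that]])
  qed (rule assms)
  have \<alpha>: "\<alpha> \<in> pverts G" and \<omega>: "\<omega> \<in> pverts G"
    using assms by (simp_all add: block_graph_def)
  have X: "block (mat_inv J) I \<alpha> \<alpha> \<in> carrier_mat (card (I \<alpha>)) (card (I \<alpha>))"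
    using \<alpha> by (simp add: P.block_mat_inv G_def)
  have C: "C \<in> carrier_mat (card (I \<alpha>)) (card (I \<alpha>))"
    and CX: "C * block (mat_inv J) I \<alpha> \<alpha> = 1\<^sub>m (card (I \<alpha>))"
    using P.cycle_sum_carrier P.cycle_sum_mult_block_inv \<alpha> unfolding C_def G_def by blast+
  show ?thesis
    using P.path_sum[of \<alpha> \<omega>] \<alpha> \<omega> invertible_matI[OF C X CX] mat_inv_eqI[OF C X CX]
    by (simp add: G_def)
qed

end
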